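(* Let $\{F_\varsigma\}_{\varsigma\in\mathfrak{A}}$ be a continuous frame for $\mathcal{H}^N$ with frame operator $S_F$. Let $\{e_k\}_{k=1}^N$ be an orthonormal basis of $\mathcal{H}^N$ consisting of eigenvectors of $S_F$, with corresponding eigenvalues $\{\beta_k\}_{k=1}^N$. Then for every $\{\alpha_k\}_{k=1}^N\subseteq(0,+\infty)$, the family $\{F_\varsigma\}_{\varsigma\in\mathfrak{A}}$ is a $V$-controlled integral frame for $\mathcal{H}^N$, where $V$ is the linear operator defined by $Ve_k=\alpha_ke_k$ for $k=1,\dots,N$.
   Context: $(\mathfrak{A},\mu)$ is a measure space with positive measure $\mu$, and $\mathcal{H}^N$ is an $N$-dimensional complex Hilbert space, with inner product linear in the first variable. Families are assumed weakly measurable: $\varsigma\mapsto\langle f,F_\varsigma\rangle$ is measurable for each $f$. A family $\{F_\varsigma\}_{\varsigma\in\mathfrak{A}}\subset\mathcal{H}^N$ is a continuous (integral) frame if there are $0<A\le B<\infty$ with $A\|f\|^2\le\int_{\mathfrak{A}}|\langle f,F_\varsigma\rangle|^2d\mu(\varsigma)\le B\|f\|^2$ for all $f$; its frame operator is $S_Ff=\int_{\mathfrak{A}}\langle f,F_\varsigma\rangle F_\varsigma\,d\mu(\varsigma)$ (weak sense). For an invertible operator $V$ on $\mathcal{H}^N$, the family is a $V$-controlled integral frame if there are $0<A\le B<\infty$ with $A\|f\|^2\le\int_{\mathfrak{A}}\langle f,F_\varsigma\rangle\langle VF_\varsigma,f\rangle\,d\mu(\varsigma)\le B\|f\|^2$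 for all $f\in\mathcal{H}^N$. *)

theory Defs
  imports "HOL-Analysis.Analysis"
begin

text \<open>
  Complex Hilbert spaces, with the inner product linear in the first variable.
  Completeness, the norm and the underlying real structure come from \<^class>\<open>banach\<close>.
\<close>

class complex_hilbert = banach +
  fixes cscale :: "complex \<Rightarrow> 'a \<Rightarrow> 'a"
    and cinner :: "'a \<Rightarrow> 'a \<Rightarrow> complex"
  assumes cscale_add_right: "cscale c (x + y) = cscale c x + cscale c y"
    and cscale_add_left: "cscale (c + d) x = cscale c x + cscale d x"
    and cscale_cscale: "cscale c (cscale d x) = cscale (c * d) x"
    and cscale_one: "cscale 1 x = x"
    and cscale_of_real: "cscale (complex_of_real r) x = r *\<^sub>R x"
    and cinner_add_left: "cinner (x + y) z = cinner x z + cinner y z"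
    and cinner_cscale_left: "cinner (cscale c x) y = c * cinner x y"
    and cinner_commute: "cinner x y = cnj (cinner y x)"
    and cinner_self: "cinner x x = complex_of_real ((norm x)\<^sup>2)"

interpretation complex_vector:
  vector_space "cscale :: complex \<Rightarrow> 'a \<Rightarrow> 'a::complex_hilbert"
  by unfold_locales
    (simp_all add: cscale_add_right cscale_add_left cscale_cscale cscale_one)

abbreviation clinear :: "('a::complex_hilbert \<Rightarrow> 'b::complex_hilbert) \<Rightarrow> bool" where
  "clinear \<equiv> Vector_Spaces.linear cscale cscale"

definition orthonormal_basis :: "nat \<Rightarrow> (nat \<Rightarrow> 'a::complex_hilbert) \<Rightarrow> bool" where
  "orthonormal_basis N e \<longleftrightarrow>
     (\<forall>j\<in>{1..N}. \<forall>k\<in>{1..N}. cinner (e j) (e k) = (if j = k then 1 else 0)) \<and>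
     complex_vector.span (e ` {1..N}) = UNIV"

definition eigenvector ::
    "('a::complex_hilbert \<Rightarrow> 'a) \<Rightarrow> complex \<Rightarrow> 'a \<Rightarrow> bool" where
  "eigenvector T c v \<longleftrightarrow> v \<noteq> 0 \<and> T v = cscale c v"

definition weakly_measurable :: "'s measure \<Rightarrow> ('s \<Rightarrow> 'a::complex_hilbert) \<Rightarrow> bool" where
  "weakly_measurable M F \<longleftrightarrow> (\<forall>f. (\<lambda>s. cinner f (F s)) \<in> borel_measurable M)"

text \<open>
  The integrand is nonnegative, so the integral is taken in \<^typ>\<open>ennreal\<close>; the upper
  bound then asserts that it is finite.
\<close>

definition continuous_frame :: "'s measure \<Rightarrow> ('s \<Rightarrow> 'a::complex_hilbert) \<Rightarrow> bool" where
  "continuous_frame M F \<longleftrightarrow>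
     weakly_measurable M F \<and>
     (\<exists>A B :: real. 0 < A \<and> A \<le> B \<and>
       (\<forall>f. ennreal (A * (norm f)\<^sup>2) \<le> (\<integral>\<^sup>+s. ennreal ((cmod (cinner f (F s)))\<^sup>2) \<partial>M) \<and>
            (\<integral>\<^sup>+s. ennreal ((cmod (cinner f (F s)))\<^sup>2) \<partial>M) \<le> ennreal (B * (norm f)\<^sup>2)))"

text \<open>
  The weak integral: the vector whose inner product with each \<open>g\<close> is the scalar integral.
  For a continuous frame it exists (Cauchy-Schwarz and Riesz) and is unique.
\<close>

definition frame_operator ::
    "'s measure \<Rightarrow> ('s \<Rightarrow> 'a::complex_hilbert) \<Rightarrow> 'a \<Rightarrow> 'a" where
  "frame_operator M F f =
     (THE h. \<forall>g. cinner h g = (\<integral>s. cinner f (F s) * cinner (F s) g \<partial>M))"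

text \<open>
  The integrand is complex valued, so the two-sided estimate includes that the integral
  exists and is a real number. The control operator is invertible by definition.
\<close>

definition controlled_integral_frame ::
    "('a::complex_hilbert \<Rightarrow> 'a) \<Rightarrow> 's measure \<Rightarrow> ('s \<Rightarrow> 'a) \<Rightarrow> bool" where
  "controlled_integral_frame V M F \<longleftrightarrow>
     clinear V \<and> bij V \<and> weakly_measurable M F \<and>
     (\<exists>A B :: real. 0 < A \<and> A \<le> B \<and>
       (\<forall>f. integrable M (\<lambda>s. cinner f (F s) * cinner (V (F s)) f) \<and>
            (\<integral>s. cinner f (F s) * cinner (V (F s)) f \<partial>M) \<in> \<real> \<and>
            A * (norm f)\<^sup>2 \<le> Re (\<integral>s. cinner f (F s) * cinner (V (F s)) f \<partial>M) \<and>
            Re (\<integral>s. cinner f (F s) * cinner (V (F s)) f \<partial>M) \<le> B * (norm f)\<^sup>2))"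

end

theory Submission
  imports Defs
begin

text \<open>
  The operator \<open>V\<close> is diagonal in an orthonormal eigenbasis of the frame operator
  \<open>S\<close>, so the controlled form \<open>f \<mapsto> \<integral> \<langle>f, F\<rangle> \<langle>V F, f\<rangle>\<close> is diagonal in that basis as well. Indeed
  \<open>\<langle>V F, f\<rangle> = \<Sum>k. \<alpha> k * \<langle>F, e k\<rangle> * \<langle>e k, f\<rangle>\<close>, and \<open>\<integral> \<langle>f, F\<rangle> \<langle>F, e k\<rangle>\<close> is the conjugate of
  \<open>\<langle>S (e k), f\<rangle> = \<beta> k * \<langle>e k, f\<rangle>\<close>; altogether the form equals
  \<open>\<Sum>k. \<alpha> k * cnj (\<beta> k) * \<bar>\<langle>f, e k\<rangle>\<bar>\<^sup>2\<close>.
  Pairing the eigenvector equation with the unit vector \<open>e k\<close> gives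
  \<open>\<beta> k = \<integral> \<bar>\<langle>e k, F\<rangle>\<bar>\<^sup>2\<close> (\<open>continuous_frame_eigenvalue\<close>), which is real and, by the frame
  inequalities for \<open>e k\<close>, lies between the frame bounds \<open>A\<close> and \<open>B\<close>. Since there are finitely many \<open>\<alpha> k > 0\<close>, they lie between
  positive constants \<open>a\<close> and \<open>b\<close>, and Parseval's identity turns the diagonal form into the
  controlled frame inequalities with bounds \<open>a * A\<close> and \<open>b * B\<close>.

  The frame operator is a definite description, so its weak characterization
  (\<open>cinner_frame_operator\<close>) needs a representing vector. In finite dimension this
  vector can be written down from its coordinates in an orthonormal basis.
\<close>

section \<open>Complex inner products and orthonormal expansions\<close>

lemma cinner_zero_left [simp]: "cinner 0 (y::'a::complex_hilbert) = 0"
  by (metis add_cancel_right_left cinner_add_left)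

lemma cinner_diff_left:
  "cinner (x - y) (z::'a::complex_hilbert) = cinner x z - cinner y z"
  by (metis add_diff_cancel_right' cinner_add_left diff_add_cancel)

lemma cinner_sum_left:
  "cinner (\<Sum>i\<in>I. f i) (y::'a::complex_hilbert) = (\<Sum>i\<in>I. cinner (f i) y)"
  by (induction I rule: infinite_finite_induct) (simp_all add: cinner_add_left)

lemma cinner_mult_flip:
  "cinner x y * cinner y (x::'a::complex_hilbert) = complex_of_real ((cmod (cinner x y))\<^sup>2)"
  by (metis cinner_commute complex_norm_square)

lemma cinner_eqI:
  fixes x y :: "'a::complex_hilbert"
  assumes "\<And>z. cinner x z = cinner y z"
  shows "x = y"
proof -
  have "cinner (x - y) (x - y) = 0"
    by (simp add: cinner_diff_left assms)
  then show ?thesis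
    by (simp add: cinner_self)
qed

lemma orthonormal_basis_cinner:
  assumes "orthonormal_basis N e" "j \<in> {1..N}" "k \<in> {1..N}"
  shows "cinner (e j) (e k) = (if j = k then 1 else 0)"
  using assms unfolding orthonormal_basis_def by blast

lemma orthonormal_basis_coefficient:
  assumes "orthonormal_basis N e" "k \<in> {1..N}"
  shows "cinner (\<Sum>j\<in>{1..N}. cscale (c j) (e j)) (e k) = c k"
proof -
  have "cinner (\<Sum>j\<in>{1..N}. cscale (c j) (e j)) (e k) = (\<Sum>j\<in>{1..N}. if j = k then c j else 0)"
    unfolding cinner_sum_left cinner_cscale_left
    by (intro sum.cong) (auto simp: orthonormal_basis_cinner[OF assms(1) _ assms(2)])
  then show ?thesis
    using assms(2) by simp
qed

text \<open>
  Both sides are linear in \<open>x\<close> and agree on the basis vectors, which span the space.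
\<close>

lemma orthonormal_basis_expansion:
  assumes "orthonormal_basis N e"
  shows "x = (\<Sum>k\<in>{1..N}. cscale (cinner x (e k)) (e k))"
proof -
  have "x \<in> complex_vector.span (e ` {1..N})"
    using assms unfolding orthonormal_basis_def by simp
  then show ?thesis
  proof (induction rule: complex_vector.span_induct_alt)
    case base
    show ?case by simp
  next
    case (step c v y)
    from step.hyps obtain j where j: "j \<in> {1..N}" "v = e j" by blast
    have "(\<Sum>k\<in>{1..N}. cscale (cinner v (e k)) (e k))
        = (\<Sum>k\<in>{1..N}. if k = j then e k else 0)"
      by (intro sum.cong) (auto simp: j orthonormal_basis_cinner[OF assms j(1)])
    then have v: "(\<Sum>k\<in>{1..N}. cscale (cinner v (e k)) (e k)) = v"
      using j by simp
    have "(\<Sum>k\<in>{1..N}. cscale (cinner (cscale c v + y) (e k)) (e k))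
        = cscale c (\<Sum>k\<in>{1..N}. cscale (cinner v (e k)) (e k))
          + (\<Sum>k\<in>{1..N}. cscale (cinner y (e k)) (e k))"
      by (simp add: cinner_add_left cinner_cscale_left cscale_add_left cscale_cscale
          complex_vector.scale_sum_right sum.distrib)
    then show ?case
      using v step.IH by simp
  qed
qed

lemma orthonormal_basis_eqI:
  assumes "orthonormal_basis N e" "\<And>k. k \<in> {1..N} \<Longrightarrow> cinner x (e k) = cinner y (e k)"
  shows "x = y"
proof -
  have "(\<Sum>k\<in>{1..N}. cscale (cinner x (e k)) (e k)) = (\<Sum>k\<in>{1..N}. cscale (cinner y (e k)) (e k))"
    by (intro sum.cong) (simp_all add: assms(2))
  then show ?thesis
    using orthonormal_basis_expansion[OF assms(1)] by metis
qed

lemma orthonormal_basis_cinner_expansion: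
  assumes "orthonormal_basis N e"
  shows "cinner x y = (\<Sum>k\<in>{1..N}. cinner x (e k) * cinner (e k) y)"
  by (subst orthonormal_basis_expansion[OF assms, of x])
    (simp add: cinner_sum_left cinner_cscale_left)

lemma orthonormal_basis_parseval:
  assumes "orthonormal_basis N e"
  shows "(norm x)\<^sup>2 = (\<Sum>k\<in>{1..N}. (cmod (cinner x (e k)))\<^sup>2)"
proof -
  have "complex_of_real ((norm x)\<^sup>2) = complex_of_real (\<Sum>k\<in>{1..N}. (cmod (cinner x (e k)))\<^sup>2)"
    unfolding cinner_self[symmetric] orthonormal_basis_cinner_expansion[OF assms, of x x]
      cinner_mult_flip by simp
  then show ?thesis
    using of_real_eq_iff by blast
qed

section \<open>Diagonal operators\<close>

lemma diagonal_operator_coefficient: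
  assumes e: "orthonormal_basis N e" and V: "clinear V"
    and diag: "\<And>k. k \<in> {1..N} \<Longrightarrow> V (e k) = cscale (a k) (e k)"
    and k: "k \<in> {1..N}"
  shows "cinner (V x) (e k) = a k * cinner x (e k)"
proof -
  interpret V: Vector_Spaces.linear cscale cscale V by (fact V)
  have "V x = (\<Sum>j\<in>{1..N}. cscale (cinner x (e j)) (V (e j)))"
    by (subst orthonormal_basis_expansion[OF e, of x]) (simp add: V.sum V.scale)
  also have "\<dots> = (\<Sum>j\<in>{1..N}. cscale (a j * cinner x (e j)) (e j))"
    by (intro sum.cong) (simp_all add: diag cscale_cscale mult.commute)
  finally show ?thesis
    by (simp only: orthonormal_basis_coefficient[OF e k])
qed

lemma diagonal_operator_bij:
  assumes e: "orthonormal_basis N e" and V: "clinear V"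
    and diag: "\<And>k. k \<in> {1..N} \<Longrightarrow> V (e k) = cscale (a k) (e k)"
    and nz: "\<And>k. k \<in> {1..N} \<Longrightarrow> a k \<noteq> 0"
  shows "bij V"
proof (rule bijI)
  note coefficient = diagonal_operator_coefficient[OF e V diag]
  show "inj V"
  proof (rule injI)
    fix x y assume "V x = V y"
    then have "a k * cinner x (e k) = a k * cinner y (e k)" if "k \<in> {1..N}" for k
      using coefficient that by metis
    then show "x = y"
      using nz by (intro orthonormal_basis_eqI[OF e]) auto
  qed
  show "surj V"
  proof (rule surjI)
    fix y
    show "V (\<Sum>k\<in>{1..N}. cscale (cinner y (e k) / a k) (e k)) = y"
      by (rule orthonormal_basis_eqI[OF e])
        (simp only: coefficient orthonormal_basis_coefficient[OF e] nz nonzero_mult_div_cancel_left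
          times_divide_eq_right not_False_eq_True)
  qed
qed

section \<open>The frame operator in an orthonormal basis\<close>

lemma weakly_measurable_cinner:
  assumes "weakly_measurable M F"
  shows "(\<lambda>s. cinner f (F s)) \<in> borel_measurable M"
    and "(\<lambda>s. cinner (F s) f) \<in> borel_measurable M"
proof -
  show "(\<lambda>s. cinner f (F s)) \<in> borel_measurable M"
    using assms unfolding weakly_measurable_def by blast
  then have "(\<lambda>s. cnj (cinner f (F s))) \<in> borel_measurable M"
    by (rule borel_measurable_continuous_on[OF continuous_on_cnj[OF continuous_on_id]])
  then show "(\<lambda>s. cinner (F s) f) \<in> borel_measurable M"
    by (simp flip: cinner_commute)
qed

lemma continuous_frame_square_integrable:
  assumes "continuous_frame M F"
  shows "integrable M (\<lambda>s. (cmod (cinner f (F s)))\<^sup>2)"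
proof (rule integrableI_nonneg)
  show "(\<lambda>s. (cmod (cinner f (F s)))\<^sup>2) \<in> borel_measurable M"
    using assms unfolding continuous_frame_def
    by (intro borel_measurable_power borel_measurable_norm[THEN measurable_compose_rev]
        weakly_measurable_cinner) blast
  obtain B where "(\<integral>\<^sup>+s. ennreal ((cmod (cinner f (F s)))\<^sup>2) \<partial>M) \<le> ennreal (B * (norm f)\<^sup>2)"
    using assms unfolding continuous_frame_def by blast
  then show "(\<integral>\<^sup>+s. ennreal ((cmod (cinner f (F s)))\<^sup>2) \<partial>M) < \<infinity>"
    by (simp add: order_le_less_trans)
qed simp

text \<open>
  By the arithmetic-geometric mean inequality, the product is dominated by the sum of two
  integrable squares.
\<close>

lemma continuous_frame_integrable:
  assumes "continuous_frame M F"
  shows "integrable M (\<lambda>s. cinner f (F s) * cinner (F s) g)"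
proof (rule Bochner_Integration.integrable_bound)
  show "integrable M (\<lambda>s. (cmod (cinner f (F s)))\<^sup>2 + (cmod (cinner g (F s)))\<^sup>2)"
    by (intro Bochner_Integration.integrable_add continuous_frame_square_integrable assms)
  have "weakly_measurable M F"
    using assms unfolding continuous_frame_def by blast
  then show "(\<lambda>s. cinner f (F s) * cinner (F s) g) \<in> borel_measurable M"
    by (intro borel_measurable_times weakly_measurable_cinner)
  have "cmod (cinner f y * cinner y g) \<le> (cmod (cinner f y))\<^sup>2 + (cmod (cinner g y))\<^sup>2" for y
  proof -
    have "cmod (cinner y g) = cmod (cinner g y)"
      by (metis cinner_commute complex_mod_cnj)
    moreover have "a * b \<le> a\<^sup>2 + b\<^sup>2" if "a \<ge> 0" "b \<ge> 0" for a b :: real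
      using sum_squares_bound[of a b] mult_nonneg_nonneg[OF that] by linarith
    ultimately show ?thesis
      by (simp add: norm_mult)
  qed
  then show "AE s in M. norm (cinner f (F s) * cinner (F s) g)
      \<le> norm ((cmod (cinner f (F s)))\<^sup>2 + (cmod (cinner g (F s)))\<^sup>2)"
    by simp
qed

lemma continuous_frame_integral_bounds:
  assumes "continuous_frame M F"
  obtains A B where "0 < A" "A \<le> B"
    "\<And>f. A * (norm f)\<^sup>2 \<le> (\<integral>s. (cmod (cinner f (F s)))\<^sup>2 \<partial>M)"
    "\<And>f. (\<integral>s. (cmod (cinner f (F s)))\<^sup>2 \<partial>M) \<le> B * (norm f)\<^sup>2"
proof -
  obtain A B where AB: "0 < A" "A \<le> B"
    and bounds: "\<And>f. ennreal (A * (norm f)\<^sup>2) \<le> (\<integral>\<^sup>+s. ennreal ((cmod (cinner f (F s)))\<^sup>2) \<partial>M)"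
      "\<And>f. (\<integral>\<^sup>+s. ennreal ((cmod (cinner f (F s)))\<^sup>2) \<partial>M) \<le> ennreal (B * (norm f)\<^sup>2)"
    using assms unfolding continuous_frame_def by blast
  have eq: "(\<integral>\<^sup>+s. ennreal ((cmod (cinner f (F s)))\<^sup>2) \<partial>M)
      = ennreal (\<integral>s. (cmod (cinner f (F s)))\<^sup>2 \<partial>M)" for f
    by (intro nn_integral_eq_integral continuous_frame_square_integrable assms) simp
  have "A * (norm f)\<^sup>2 \<le> (\<integral>s. (cmod (cinner f (F s)))\<^sup>2 \<partial>M)" for f
    using bounds(1)[of f] by (simp add: eq)
  moreover have "(\<integral>s. (cmod (cinner f (F s)))\<^sup>2 \<partial>M) \<le> B * (norm f)\<^sup>2" for f
    using bounds(2)[of f] AB by (simp add: eq)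
  ultimately show ?thesis
    using that AB by blast
qed

text \<open>
  The vector with coordinates \<open>\<integral> \<langle>f, F\<rangle> \<langle>F, e k\<rangle>\<close> represents the weak integral, and a vector
  is determined by its inner products, so the description of the frame operator is proper.
\<close>

lemma cinner_frame_operator:
  fixes F :: "'s \<Rightarrow> 'a::complex_hilbert" and e :: "nat \<Rightarrow> 'a"
  assumes F: "continuous_frame M F" and e: "orthonormal_basis N e"
  shows "cinner (frame_operator M F f) g = (\<integral>s. cinner f (F s) * cinner (F s) g \<partial>M)"
proof -
  define h where "h = (\<Sum>k\<in>{1..N}. cscale (\<integral>s. cinner f (F s) * cinner (F s) (e k) \<partial>M) (e k))"
  have h: "cinner h g = (\<integral>s. cinner f (F s) * cinner (F s) g \<partial>M)" for g
  proof -
    have "(\<integral>s. cinner f (F s) * cinner (F s) g \<partial>M)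
        = (\<integral>s. (\<Sum>k\<in>{1..N}. cinner f (F s) * cinner (F s) (e k) * cinner (e k) g) \<partial>M)"
      by (subst orthonormal_basis_cinner_expansion[OF e, of _ g])
        (simp add: sum_distrib_left mult.assoc)
    also have "\<dots> = (\<Sum>k\<in>{1..N}. (\<integral>s. cinner f (F s) * cinner (F s) (e k) \<partial>M) * cinner (e k) g)"
      by (simp add: continuous_frame_integrable[OF F])
    finally show ?thesis
      by (simp add: h_def cinner_sum_left cinner_cscale_left)
  qed
  have "frame_operator M F f = h"
    unfolding frame_operator_def
  proof (rule the_equality)
    show "\<forall>g. cinner h g = (\<integral>s. cinner f (F s) * cinner (F s) g \<partial>M)"
      using h by blast
    show "h' = h" if "\<forall>g. cinner h' g = (\<integral>s. cinner f (F s) * cinner (F s) g \<partial>M)" for h'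
      by (rule cinner_eqI) (simp only: h that)
  qed
  then show ?thesis
    by (simp add: h)
qed

lemma continuous_frame_eigenvalue:
  fixes F :: "'s \<Rightarrow> 'a::complex_hilbert" and e :: "nat \<Rightarrow> 'a"
  assumes F: "continuous_frame M F" and e: "orthonormal_basis N e"
    and v: "eigenvector (frame_operator M F) c v" and norm: "norm v = 1"
  shows "c = complex_of_real (\<integral>s. (cmod (cinner v (F s)))\<^sup>2 \<partial>M)"
proof -
  have "c = cinner (frame_operator M F v) v"
    using v norm by (simp add: eigenvector_def cinner_cscale_left cinner_self)
  then show ?thesis
    by (simp add: cinner_frame_operator[OF F e] cinner_mult_flip del: of_real_power)
qed

section \<open>The controlled form\<close>

text \<open>
  Expanding \<open>V F\<close> leaves the integrals of \<open>\<langle>f, F\<rangle> \<langle>F, e k\<rangle>\<close>. Such an integral is the conjugate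
  of \<open>\<langle>S (e k), f\<rangle>\<close>, where \<open>S\<close> is the frame operator, and this is where the eigenvector
  equation enters; hence the conjugate on \<open>b k\<close>.
\<close>

lemma controlled_form_diagonal:
  assumes F: "continuous_frame M F" and e: "orthonormal_basis N e"
    and eig: "\<And>k. k \<in> {1..N} \<Longrightarrow> eigenvector (frame_operator M F) (b k) (e k)"
    and V: "clinear V"
    and diag: "\<And>k. k \<in> {1..N} \<Longrightarrow> V (e k) = cscale (a k) (e k)"
  shows "integrable M (\<lambda>s. cinner f (F s) * cinner (V (F s)) f)"
    and "(\<integral>s. cinner f (F s) * cinner (V (F s)) f \<partial>M)
      = (\<Sum>k\<in>{1..N}. a k * cnj (b k) * complex_of_real ((cmod (cinner f (e k)))\<^sup>2))"
proof -
  have expand: "cinner f y * cinner (V y) f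
      = (\<Sum>k\<in>{1..N}. a k * cinner (e k) f * (cinner f y * cinner y (e k)))" for y
    unfolding orthonormal_basis_cinner_expansion[OF e, of "V y" f] sum_distrib_left
    by (intro sum.cong) (simp_all only: diagonal_operator_coefficient[OF e V diag] mult_ac)
  show "integrable M (\<lambda>s. cinner f (F s) * cinner (V (F s)) f)"
    unfolding expand
    by (intro Bochner_Integration.integrable_sum integrable_mult_right
        continuous_frame_integrable[OF F])
  have coefficient: "(\<integral>s. cinner f (F s) * cinner (F s) (e k) \<partial>M) = cnj (b k) * cinner f (e k)"
    if "k \<in> {1..N}" for k
  proof -
    have "cinner f y * cinner y (e k) = cnj (cinner (e k) y * cinner y f)" for y
      by (metis cinner_commute complex_cnj_mult mult.commute)
    then have "(\<integral>s. cinner f (F s) * cinner (F s) (e k) \<partial>M)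
        = cnj (\<integral>s. cinner (e k) (F s) * cinner (F s) f \<partial>M)"
      by (simp only: Bochner_Integration.integral_cnj)
    also have "\<dots> = cnj (cinner (cscale (b k) (e k)) f)"
      using eig[OF that] by (simp add: eigenvector_def flip: cinner_frame_operator[OF F e])
    also have "\<dots> = cnj (b k) * cinner f (e k)"
      by (simp add: cinner_cscale_left flip: cinner_commute)
    finally show ?thesis .
  qed
  have "(\<integral>s. cinner f (F s) * cinner (V (F s)) f \<partial>M)
      = (\<Sum>k\<in>{1..N}. a k * cinner (e k) f * (\<integral>s. cinner f (F s) * cinner (F s) (e k) \<partial>M))"
    unfolding expand by (simp add: continuous_frame_integrable[OF F])
  also have "\<dots> = (\<Sum>k\<in>{1..N}. a k * cnj (b k) * (cinner f (e k) * cinner (e k) f))"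
    by (intro sum.cong) (simp_all add: coefficient mult_ac)
  finally show "(\<integral>s. cinner f (F s) * cinner (V (F s)) f \<partial>M)
      = (\<Sum>k\<in>{1..N}. a k * cnj (b k) * complex_of_real ((cmod (cinner f (e k)))\<^sup>2))"
    unfolding cinner_mult_flip .
qed

lemma finite_positive_bounds:
  fixes a :: "'b \<Rightarrow> real"
  assumes "finite I" "\<And>i. i \<in> I \<Longrightarrow> 0 < a i"
  obtains l u where "0 < l" "l \<le> u" "\<And>i. i \<in> I \<Longrightarrow> l \<le> a i" "\<And>i. i \<in> I \<Longrightarrow> a i \<le> u"
proof
  (* The extra element 1 keeps the sets nonempty when I is empty. *)
  let ?S = "insert 1 (a ` I)"
  show "0 < Min ?S"
    using assms by (subst Min_gr_iff) auto
  show "Min ?S \<le> Max ?S"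
    using assms by (intro Min_le_iff[THEN iffD2]) (auto intro!: bexI[of _ 1])
  show "\<And>i. i \<in> I \<Longrightarrow> Min ?S \<le> a i" "\<And>i. i \<in> I \<Longrightarrow> a i \<le> Max ?S"
    using assms(1) by (auto intro!: Min_le Max_ge)
qed

theorem proposition2p10:
  fixes M :: "'s measure"
    and F :: "'s \<Rightarrow> 'a::complex_hilbert"
    and N :: nat
    and e :: "nat \<Rightarrow> 'a"
    and \<beta> :: "nat \<Rightarrow> complex"
    and \<alpha> :: "nat \<Rightarrow> real"
    and V :: "'a \<Rightarrow> 'a"
  assumes "complex_vector.dim (UNIV :: 'a set) = N"
    and "continuous_frame M F"
    and "orthonormal_basis N e"
    and "\<And>k. k \<in> {1..N} \<Longrightarrow> eigenvector (frame_operator M F) (\<beta> k) (e k)"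
    and "\<And>k. k \<in> {1..N} \<Longrightarrow> 0 < \<alpha> k"
    and "clinear V"
    and "\<And>k. k \<in> {1..N} \<Longrightarrow> V (e k) = cscale (complex_of_real (\<alpha> k)) (e k)"
  shows "controlled_integral_frame V M F"
proof -
  note F = assms(2) and e = assms(3) and eig = assms(4) and pos = assms(5)
    and V = assms(6) and diag = assms(7)
  obtain A B where AB: "0 < A" "A \<le> B"
    and bounds: "\<And>f. A * (norm f)\<^sup>2 \<le> (\<integral>s. (cmod (cinner f (F s)))\<^sup>2 \<partial>M)"
      "\<And>f. (\<integral>s. (cmod (cinner f (F s)))\<^sup>2 \<partial>M) \<le> B * (norm f)\<^sup>2"
    using continuous_frame_integral_bounds[OF F] by blast
  obtain a b where ab: "0 < a" "a \<le> b"
    and \<alpha>: "\<And>k. k \<in> {1..N} \<Longrightarrow> a \<le> \<alpha> k" "\<And>k. k \<in> {1..N} \<Longrightarrow> \<alpha> k \<le> b"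
    by (rule finite_positive_bounds[of "{1..N}" \<alpha>]) (use pos in auto)
  define r where "r k = (\<integral>s. (cmod (cinner (e k) (F s)))\<^sup>2 \<partial>M)" for k
  have norm_e: "norm (e k) = 1" if "k \<in> {1..N}" for k
    using orthonormal_basis_cinner[OF e that that]
    by (simp add: cinner_self flip: of_real_power)
      (smt (verit) norm_ge_zero power2_eq_1_iff)
  have \<beta>: "\<beta> k = complex_of_real (r k)" if "k \<in> {1..N}" for k
    unfolding r_def by (rule continuous_frame_eigenvalue[OF F e eig norm_e]) (use that in auto)
  have r: "A \<le> r k" "r k \<le> B" if "k \<in> {1..N}" for k
    using bounds[of "e k"] by (simp_all only: r_def norm_e[OF that] power_one mult_1_right)
  define Q where "Q f = (\<Sum>k\<in>{1..N}. \<alpha> k * r k * (cmod (cinner f (e k)))\<^sup>2)" for f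
  have form: "(\<integral>s. cinner f (F s) * cinner (V (F s)) f \<partial>M) = complex_of_real (Q f)" for f
  proof -
    have "(\<integral>s. cinner f (F s) * cinner (V (F s)) f \<partial>M) = (\<Sum>k\<in>{1..N}.
        complex_of_real (\<alpha> k) * cnj (\<beta> k) * complex_of_real ((cmod (cinner f (e k)))\<^sup>2))"
      by (rule controlled_form_diagonal(2)[OF F e eig V diag])
    also have "\<dots> = complex_of_real (Q f)"
      unfolding Q_def of_real_sum by (intro sum.cong) (simp_all add: \<beta>)
    finally show ?thesis .
  qed
  have form_integrable: "integrable M (\<lambda>s. cinner f (F s) * cinner (V (F s)) f)" for f
    by (rule controlled_form_diagonal(1)[OF F e eig V diag])
  have lower: "a * A * (norm f)\<^sup>2 \<le> Q f" for f
    unfolding Q_def orthonormal_basis_parseval[OF e] sum_distrib_left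
    using AB(1) ab(1) \<alpha>(1) r(1) pos
    by (intro sum_mono mult_right_mono mult_mono) (auto intro: less_imp_le)
  have upper: "Q f \<le> b * B * (norm f)\<^sup>2" for f
    unfolding Q_def orthonormal_basis_parseval[OF e] sum_distrib_left
    using AB ab \<alpha>(2) r
    by (intro sum_mono mult_right_mono mult_mono) (auto intro: order_trans[OF less_imp_le])
  have "bij V"
    using pos by (intro diagonal_operator_bij[OF e V diag]) force+
  moreover have "weakly_measurable M F"
    using F unfolding continuous_frame_def by blast
  moreover have "0 < a * A" "a * A \<le> b * B"
    using AB ab by (auto intro: mult_mono)
  ultimately show ?thesis
    unfolding controlled_integral_frame_def
    using V form_integrable lower upper form
    by (intro conjI exI[of _ "a * A"] exI[of _ "b * B"]) auto
qed

end
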